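(* Let $t$ be a proof term and $A$ a formula of the natural deduction system $\mathsf{CD}$, and suppose $t:A$ in $\mathsf{CD}$. Then $t$ is strongly normalizable with respect to the relation $\mapsto$, that is, there is no infinite sequence $t=t_1\mapsto t_2\mapsto t_3\mapsto\cdots$.
   Context: **Language $\mathcal{L}$ of $\mathsf{CD}$.** First-order terms are variables $\alpha,\beta,\dots$, constants $\mathsf{c}$, and expressions $\mathsf{f}(m_1,\dots,m_n)$ with $\mathsf{f}$ an $n$-ary function constant and $m_1,\dots,m_n$ terms. There is a countable set of predicate symbols, including a $0$-ary symbol $\bot$ (falsity). Atomic formulas are $\mathcal{P}(m_1,\dots,m_n)$ with $\mathcal{P}$ an $n$-ary predicate symbol. Formulas are built from atomic formulas with $\lor,\land,\rightarrow,\forall,\exists$; $\lnot A$ abbreviates $A\rightarrow\bot$. A constant $\mathsf{0}$ of $\mathcal{L}$ is fixed. **Typing rules of $\mathsf{CD}$** (natural deduction with proof terms; proof-term variables $x^A$ carry their type $A$; square-bracketed assumptions are discharged; terms are considered up to renaming of bound variables and substitution is capture-avoiding). - Axiom: $x^A : A$. - Conjunction: from $u:A$ and $t:B$ infer $\langle u,t\rangle : A\wedge B$; from $u:A\wedge B$ infer $u\,\pi_0 : A$ and $u\,\pi_1 : B$. - Implication: from $t:A\rightarrow B$ and $u:A$ infer $t\,u:B$; from $u:B$ infer $\lambda x^A u : A\rightarrow B$ (binding $x^A$, discharging $[x^A:A]$). - Disjunction: from $u:A$ infer $\iota_0(u):A\lor B$; from $u:B$ infer $\iota_1(u):A\lor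 B$; from $u:A\lor B$, $w_1:C$ and $w_2:C$ infer $u\,[x^A.w_1,\,y^B.w_2] : C$ (binding $x^A$ in $w_1$ and $y^B$ in $w_2$). - Universal quantifier: from $u:\forall\alpha\,A$ infer $u\,m : A[m/\alpha]$ for any term $m$ of $\mathcal{L}$; from $u:A$ infer $\lambda\alpha\,u:\forall\alpha\,A$, provided $\alpha$ does not occur free in the type $B$ of any free variable $x^B$ of $u$. - Existential quantifier: from $u:A[m/\alpha]$ infer $(m,u):\exists\alpha\,A$; from $u:\exists\alpha\,A$ and $t:C$ infer $u\,[(\alpha,x^A).t]:C$ (binding $\alpha$ and $x^A$ in $t$), provided $\alpha$ is not free in $C$ nor in the type $B$ of any free variable of $t$ other than $x^A$. - Constant domain axiom: for each formula $I=\forall\alpha(A\lor B)\rightarrow \forall\alpha A\lor B$ with $\alpha$ not occurring in $B$, a constant $\mathcal{D}^I : I$ (also written $\mathcal{D}$). - Ex falso: from $u:\bot$ infer $\mathsf{efq}_P\,u : P$, with $P$ atomic. The notation $t:A$ means that $t$ is a proof term (possibly with free variables) assigned the type $A$ by these rules. **Reduction rules.** $(\lambda x.u)t\mapsto u[t/x]$; $(\lambda\alpha.u)m\mapsto u[m/\alpha]$; $\langle u_0,u_1\rangle\pi_i\mapsto u_i$ for $i=0,1$; $\iota_i(u)[x_0.t_0,x_1.t_1]\mapsto t_i[u/x_i]$ for $i=0,1$; $(m,u)[(\alpha,x).v]\mapsto v[m/\alpha][u/x]$ for each term $m$ of $\mathcal{L}$; $\mathcal{D}(\lambda\alpha\,\iota_0(u))\mapsto\iota_0(\lambda\alpha\,u)$;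 $\mathcal{D}(\lambda\alpha\,\iota_1(u))\mapsto\iota_1(u[\mathsf{0}/\alpha])$. For arbitrary proof terms, $t\mapsto u$ holds whenever $u$ is obtained from $t$ by applying one reduction rule to a subterm of $t$. *)

theory Defs
  imports "HOL-Library.Countable"
begin

text \<open>
  Bound variables are represented by de Bruijn indices, so that syntactic equality is equality
  up to renaming. There are two independent sorts of indices: those of first-order variables
  (in terms, formulas and proof terms) and those of proof-term variables (in proof terms only).
  Indices that point beyond all enclosing binders are free variables.
\<close>

section \<open>The first-order language\<close>

text \<open>
  The constants of the language are its function symbols of arity 0. The field \<open>bot\<close> is the
  predicate symbol of falsity, and \<open>zero\<close> is the fixed constant used by the reduction rules.
\<close>

record ('f, 'p) signature =
  fun_arity :: "'f \<Rightarrow> nat"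
  pred_arity :: "'p \<Rightarrow> nat"
  bot :: 'p
  zero :: 'f

definition wf_signature :: "('f, 'p) signature \<Rightarrow> bool" where
  "wf_signature S \<longleftrightarrow> pred_arity S (bot S) = 0 \<and> fun_arity S (zero S) = 0"

datatype 'f tm = TVar nat | Fn 'f "'f tm list"

datatype ('f, 'p) fm =
    Atom 'p "'f tm list"
  | Or "('f, 'p) fm" "('f, 'p) fm"
  | And "('f, 'p) fm" "('f, 'p) fm"
  | Imp "('f, 'p) fm" "('f, 'p) fm"
  | Forall "('f, 'p) fm"
  | Exists "('f, 'p) fm"

text \<open>The raw syntax admits arbitrary argument lists; these predicates impose the arities.\<close>

fun wf_tm :: "('f, 'p) signature \<Rightarrow> 'f tm \<Rightarrow> bool" where
  "wf_tm S (TVar n) \<longleftrightarrow> True"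
| "wf_tm S (Fn f ms) \<longleftrightarrow> length ms = fun_arity S f \<and> (\<forall>m \<in> set ms. wf_tm S m)"

primrec wf_fm :: "('f, 'p) signature \<Rightarrow> ('f, 'p) fm \<Rightarrow> bool" where
  "wf_fm S (Atom p ms) \<longleftrightarrow> length ms = pred_arity S p \<and> (\<forall>m \<in> set ms. wf_tm S m)"
| "wf_fm S (Or A B) \<longleftrightarrow> wf_fm S A \<and> wf_fm S B"
| "wf_fm S (And A B) \<longleftrightarrow> wf_fm S A \<and> wf_fm S B"
| "wf_fm S (Imp A B) \<longleftrightarrow> wf_fm S A \<and> wf_fm S B"
| "wf_fm S (Forall A) \<longleftrightarrow> wf_fm S A"
| "wf_fm S (Exists A) \<longleftrightarrow> wf_fm S A"

section \<open>Substitution of first-order terms\<close>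

text \<open>
  Substitutions are simultaneous. \<open>up_tm \<sigma>\<close> is \<open>\<sigma>\<close> moved under a first-order binder,
  \<open>inst_tm m\<close> replaces the outermost variable by \<open>m\<close> and removes its binder.
\<close>

primrec subst_tm :: "(nat \<Rightarrow> 'f tm) \<Rightarrow> 'f tm \<Rightarrow> 'f tm" where
  "subst_tm \<sigma> (TVar n) = \<sigma> n"
| "subst_tm \<sigma> (Fn f ms) = Fn f (map (subst_tm \<sigma>) ms)"

definition shift_tm :: "nat \<Rightarrow> 'f tm" where
  "shift_tm n = TVar (Suc n)"

definition up_tm :: "(nat \<Rightarrow> 'f tm) \<Rightarrow> nat \<Rightarrow> 'f tm" where
  "up_tm \<sigma> n = (case n of 0 \<Rightarrow> TVar 0 | Suc k \<Rightarrow> subst_tm shift_tm (\<sigma> k))"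

definition inst_tm :: "'f tm \<Rightarrow> nat \<Rightarrow> 'f tm" where
  "inst_tm m n = (case n of 0 \<Rightarrow> m | Suc k \<Rightarrow> TVar k)"

primrec subst_fm :: "(nat \<Rightarrow> 'f tm) \<Rightarrow> ('f, 'p) fm \<Rightarrow> ('f, 'p) fm" where
  "subst_fm \<sigma> (Atom p ms) = Atom p (map (subst_tm \<sigma>) ms)"
| "subst_fm \<sigma> (Or A B) = Or (subst_fm \<sigma> A) (subst_fm \<sigma> B)"
| "subst_fm \<sigma> (And A B) = And (subst_fm \<sigma> A) (subst_fm \<sigma> B)"
| "subst_fm \<sigma> (Imp A B) = Imp (subst_fm \<sigma> A) (subst_fm \<sigma> B)"
| "subst_fm \<sigma> (Forall A) = Forall (subst_fm (up_tm \<sigma>) A)"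
| "subst_fm \<sigma> (Exists A) = Exists (subst_fm (up_tm \<sigma>) A)"

text \<open>
  \<open>lift_fm B\<close> is \<open>B\<close> read under one more first-order binder. The formulas of this form are
  exactly those in which the variable of that binder does not occur free.
\<close>

definition lift_fm :: "('f, 'p) fm \<Rightarrow> ('f, 'p) fm" where
  "lift_fm = subst_fm shift_tm"

section \<open>Proof terms\<close>

text \<open>
  \<open>Case u A v B w\<close> is \<open>u [x\<^sup>A. v, y\<^sup>B. w]\<close>.
  \<open>Unpack u A v\<close> is \<open>u [(\<alpha>, x\<^sup>A). v]\<close>, where \<open>\<alpha>\<close> is bound in both \<open>A\<close> and \<open>v\<close>.
  \<open>CDAx A B\<close> is the constant for \<open>\<forall>\<alpha> (A \<or> B) \<rightarrow> \<forall>\<alpha> A \<or> B\<close>,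
  where \<open>\<alpha>\<close> is bound in \<open>A\<close> while \<open>B\<close> is outside its scope.
  \<open>Lam\<close> and \<open>App\<close> concern implication, \<open>TLam\<close> and \<open>TApp\<close> the universal quantifier.
\<close>

datatype ('f, 'p) pt =
    Hyp nat
  | Tuple "('f, 'p) pt" "('f, 'p) pt"
  | Proj0 "('f, 'p) pt"
  | Proj1 "('f, 'p) pt"
  | Lam "('f, 'p) fm" "('f, 'p) pt"
  | App "('f, 'p) pt" "('f, 'p) pt"
  | Inj0 "('f, 'p) pt"
  | Inj1 "('f, 'p) pt"
  | Case "('f, 'p) pt" "('f, 'p) fm" "('f, 'p) pt" "('f, 'p) fm" "('f, 'p) pt"
  | TLam "('f, 'p) pt"
  | TApp "('f, 'p) pt" "'f tm"
  | Pack "'f tm" "('f, 'p) pt"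
  | Unpack "('f, 'p) pt" "('f, 'p) fm" "('f, 'p) pt"
  | CDAx "('f, 'p) fm" "('f, 'p) fm"
  | Efq "('f, 'p) fm" "('f, 'p) pt"

primrec tsubst_pt :: "(nat \<Rightarrow> 'f tm) \<Rightarrow> ('f, 'p) pt \<Rightarrow> ('f, 'p) pt" where
  "tsubst_pt \<sigma> (Hyp i) = Hyp i"
| "tsubst_pt \<sigma> (Tuple u v) = Tuple (tsubst_pt \<sigma> u) (tsubst_pt \<sigma> v)"
| "tsubst_pt \<sigma> (Proj0 u) = Proj0 (tsubst_pt \<sigma> u)"
| "tsubst_pt \<sigma> (Proj1 u) = Proj1 (tsubst_pt \<sigma> u)"
| "tsubst_pt \<sigma> (Lam A u) = Lam (subst_fm \<sigma> A) (tsubst_pt \<sigma> u)"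
| "tsubst_pt \<sigma> (App u v) = App (tsubst_pt \<sigma> u) (tsubst_pt \<sigma> v)"
| "tsubst_pt \<sigma> (Inj0 u) = Inj0 (tsubst_pt \<sigma> u)"
| "tsubst_pt \<sigma> (Inj1 u) = Inj1 (tsubst_pt \<sigma> u)"
| "tsubst_pt \<sigma> (Case u A v B w) =
     Case (tsubst_pt \<sigma> u) (subst_fm \<sigma> A) (tsubst_pt \<sigma> v) (subst_fm \<sigma> B) (tsubst_pt \<sigma> w)"
| "tsubst_pt \<sigma> (TLam u) = TLam (tsubst_pt (up_tm \<sigma>) u)"
| "tsubst_pt \<sigma> (TApp u m) = TApp (tsubst_pt \<sigma> u) (subst_tm \<sigma> m)"
| "tsubst_pt \<sigma> (Pack m u) = Pack (subst_tm \<sigma> m) (tsubst_pt \<sigma> u)"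
| "tsubst_pt \<sigma> (Unpack u A v) =
     Unpack (tsubst_pt \<sigma> u) (subst_fm (up_tm \<sigma>) A) (tsubst_pt (up_tm \<sigma>) v)"
| "tsubst_pt \<sigma> (CDAx A B) = CDAx (subst_fm (up_tm \<sigma>) A) (subst_fm \<sigma> B)"
| "tsubst_pt \<sigma> (Efq P u) = Efq (subst_fm \<sigma> P) (tsubst_pt \<sigma> u)"

section \<open>Substitution of proof terms\<close>

definition up_ren :: "(nat \<Rightarrow> nat) \<Rightarrow> nat \<Rightarrow> nat" where
  "up_ren \<xi> i = (case i of 0 \<Rightarrow> 0 | Suc j \<Rightarrow> Suc (\<xi> j))"

primrec rename_pt :: "(nat \<Rightarrow> nat) \<Rightarrow> ('f, 'p) pt \<Rightarrow> ('f, 'p) pt" where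
  "rename_pt \<xi> (Hyp i) = Hyp (\<xi> i)"
| "rename_pt \<xi> (Tuple u v) = Tuple (rename_pt \<xi> u) (rename_pt \<xi> v)"
| "rename_pt \<xi> (Proj0 u) = Proj0 (rename_pt \<xi> u)"
| "rename_pt \<xi> (Proj1 u) = Proj1 (rename_pt \<xi> u)"
| "rename_pt \<xi> (Lam A u) = Lam A (rename_pt (up_ren \<xi>) u)"
| "rename_pt \<xi> (App u v) = App (rename_pt \<xi> u) (rename_pt \<xi> v)"
| "rename_pt \<xi> (Inj0 u) = Inj0 (rename_pt \<xi> u)"
| "rename_pt \<xi> (Inj1 u) = Inj1 (rename_pt \<xi> u)"
| "rename_pt \<xi> (Case u A v B w) =
     Case (rename_pt \<xi> u) A (rename_pt (up_ren \<xi>) v) B (rename_pt (up_ren \<xi>) w)"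
| "rename_pt \<xi> (TLam u) = TLam (rename_pt \<xi> u)"
| "rename_pt \<xi> (TApp u m) = TApp (rename_pt \<xi> u) m"
| "rename_pt \<xi> (Pack m u) = Pack m (rename_pt \<xi> u)"
| "rename_pt \<xi> (Unpack u A v) = Unpack (rename_pt \<xi> u) A (rename_pt (up_ren \<xi>) v)"
| "rename_pt \<xi> (CDAx A B) = CDAx A B"
| "rename_pt \<xi> (Efq P u) = Efq P (rename_pt \<xi> u)"

text \<open>
  \<open>up_pt \<theta>\<close> and \<open>tup_pt \<theta>\<close> are \<open>\<theta>\<close> moved under a binder of a proof-term variable and under a
  first-order binder, respectively.
\<close>

definition up_pt :: "(nat \<Rightarrow> ('f, 'p) pt) \<Rightarrow> nat \<Rightarrow> ('f, 'p) pt" where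
  "up_pt \<theta> i = (case i of 0 \<Rightarrow> Hyp 0 | Suc j \<Rightarrow> rename_pt Suc (\<theta> j))"

definition tup_pt :: "(nat \<Rightarrow> ('f, 'p) pt) \<Rightarrow> nat \<Rightarrow> ('f, 'p) pt" where
  "tup_pt \<theta> i = tsubst_pt shift_tm (\<theta> i)"

definition inst_pt :: "('f, 'p) pt \<Rightarrow> nat \<Rightarrow> ('f, 'p) pt" where
  "inst_pt t i = (case i of 0 \<Rightarrow> t | Suc j \<Rightarrow> Hyp j)"

primrec subst_pt :: "(nat \<Rightarrow> ('f, 'p) pt) \<Rightarrow> ('f, 'p) pt \<Rightarrow> ('f, 'p) pt" where
  "subst_pt \<theta> (Hyp i) = \<theta> i"
| "subst_pt \<theta> (Tuple u v) = Tuple (subst_pt \<theta> u) (subst_pt \<theta> v)"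
| "subst_pt \<theta> (Proj0 u) = Proj0 (subst_pt \<theta> u)"
| "subst_pt \<theta> (Proj1 u) = Proj1 (subst_pt \<theta> u)"
| "subst_pt \<theta> (Lam A u) = Lam A (subst_pt (up_pt \<theta>) u)"
| "subst_pt \<theta> (App u v) = App (subst_pt \<theta> u) (subst_pt \<theta> v)"
| "subst_pt \<theta> (Inj0 u) = Inj0 (subst_pt \<theta> u)"
| "subst_pt \<theta> (Inj1 u) = Inj1 (subst_pt \<theta> u)"
| "subst_pt \<theta> (Case u A v B w) =
     Case (subst_pt \<theta> u) A (subst_pt (up_pt \<theta>) v) B (subst_pt (up_pt \<theta>) w)"
| "subst_pt \<theta> (TLam u) = TLam (subst_pt (tup_pt \<theta>) u)"
| "subst_pt \<theta> (TApp u m) = TApp (subst_pt \<theta> u) m"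
| "subst_pt \<theta> (Pack m u) = Pack m (subst_pt \<theta> u)"
| "subst_pt \<theta> (Unpack u A v) =
     Unpack (subst_pt \<theta> u) A (subst_pt (up_pt (tup_pt \<theta>)) v)"
| "subst_pt \<theta> (CDAx A B) = CDAx A B"
| "subst_pt \<theta> (Efq P u) = Efq P (subst_pt \<theta> u)"

section \<open>Typing\<close>

text \<open>
  \<open>has_type S \<Gamma> t A\<close> says that \<open>t : A\<close> when the free variable with index \<open>i\<close> carries the
  type \<open>\<Gamma> ! i\<close>; bound variables carry the type annotated at their binder. Under a first-order
  binder the context is lifted, so the eigenvariable conditions are built into the rules.
  The premises \<open>wf_fm\<close> and \<open>wf_tm\<close> ensure that only formulas and terms of the language
  \<open>S\<close> are used; they are omitted where they follow from the other premises.
\<close>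

inductive has_type ::
  "('f, 'p) signature \<Rightarrow> ('f, 'p) fm list \<Rightarrow> ('f, 'p) pt \<Rightarrow> ('f, 'p) fm \<Rightarrow> bool"
  for S :: "('f, 'p) signature" where
  Ax: "i < length \<Gamma> \<Longrightarrow> \<Gamma> ! i = A \<Longrightarrow> wf_fm S A \<Longrightarrow> has_type S \<Gamma> (Hyp i) A"
| AndI: "has_type S \<Gamma> u A \<Longrightarrow> has_type S \<Gamma> t B \<Longrightarrow> has_type S \<Gamma> (Tuple u t) (And A B)"
| AndE0: "has_type S \<Gamma> u (And A B) \<Longrightarrow> has_type S \<Gamma> (Proj0 u) A"
| AndE1: "has_type S \<Gamma> u (And A B) \<Longrightarrow> has_type S \<Gamma> (Proj1 u) B"
| ImpE: "has_type S \<Gamma> t (Imp A B) \<Longrightarrow> has_type S \<Gamma> u A \<Longrightarrow> has_type S \<Gamma> (App t u) B"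
| ImpI: "wf_fm S A \<Longrightarrow> has_type S (A # \<Gamma>) u B \<Longrightarrow> has_type S \<Gamma> (Lam A u) (Imp A B)"
| OrI0: "has_type S \<Gamma> u A \<Longrightarrow> wf_fm S B \<Longrightarrow> has_type S \<Gamma> (Inj0 u) (Or A B)"
| OrI1: "has_type S \<Gamma> u B \<Longrightarrow> wf_fm S A \<Longrightarrow> has_type S \<Gamma> (Inj1 u) (Or A B)"
| OrE: "has_type S \<Gamma> u (Or A B) \<Longrightarrow> has_type S (A # \<Gamma>) v C \<Longrightarrow> has_type S (B # \<Gamma>) w C
    \<Longrightarrow> has_type S \<Gamma> (Case u A v B w) C"
| ForallE: "has_type S \<Gamma> u (Forall A) \<Longrightarrow> wf_tm S m
    \<Longrightarrow> has_type S \<Gamma> (TApp u m) (subst_fm (inst_tm m) A)"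
| ForallI: "has_type S (map lift_fm \<Gamma>) u A \<Longrightarrow> has_type S \<Gamma> (TLam u) (Forall A)"
| ExistsI: "wf_tm S m \<Longrightarrow> wf_fm S A \<Longrightarrow> has_type S \<Gamma> u (subst_fm (inst_tm m) A)
    \<Longrightarrow> has_type S \<Gamma> (Pack m u) (Exists A)"
| ExistsE: "has_type S \<Gamma> u (Exists A) \<Longrightarrow> has_type S (A # map lift_fm \<Gamma>) t (lift_fm C)
    \<Longrightarrow> has_type S \<Gamma> (Unpack u A t) C"
| CD: "wf_fm S A \<Longrightarrow> wf_fm S B
    \<Longrightarrow> has_type S \<Gamma> (CDAx A B) (Imp (Forall (Or A (lift_fm B))) (Or (Forall A) B))"
| ExFalso: "has_type S \<Gamma> u (Atom (bot S) []) \<Longrightarrow> wf_fm S (Atom p ms)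
    \<Longrightarrow> has_type S \<Gamma> (Efq (Atom p ms) u) (Atom p ms)"

section \<open>Reduction\<close>

inductive contract :: "('f, 'p) signature \<Rightarrow> ('f, 'p) pt \<Rightarrow> ('f, 'p) pt \<Rightarrow> bool"
  for S :: "('f, 'p) signature" where
  "contract S (App (Lam A u) t) (subst_pt (inst_pt t) u)"
| "contract S (TApp (TLam u) m) (tsubst_pt (inst_tm m) u)"
| "contract S (Proj0 (Tuple u0 u1)) u0"
| "contract S (Proj1 (Tuple u0 u1)) u1"
| "contract S (Case (Inj0 u) A t0 B t1) (subst_pt (inst_pt u) t0)"
| "contract S (Case (Inj1 u) A t0 B t1) (subst_pt (inst_pt u) t1)"
| "contract S (Unpack (Pack m u) A v) (subst_pt (inst_pt u) (tsubst_pt (inst_tm m) v))"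
| "contract S (App (CDAx A B) (TLam (Inj0 u))) (Inj0 (TLam u))"
| "contract S (App (CDAx A B) (TLam (Inj1 u))) (Inj1 (tsubst_pt (inst_tm (Fn (zero S) [])) u))"

inductive step :: "('f, 'p) signature \<Rightarrow> ('f, 'p) pt \<Rightarrow> ('f, 'p) pt \<Rightarrow> bool"
  for S :: "('f, 'p) signature" where
  "contract S t t' \<Longrightarrow> step S t t'"
| "step S u u' \<Longrightarrow> step S (Tuple u v) (Tuple u' v)"
| "step S v v' \<Longrightarrow> step S (Tuple u v) (Tuple u v')"
| "step S u u' \<Longrightarrow> step S (Proj0 u) (Proj0 u')"
| "step S u u' \<Longrightarrow> step S (Proj1 u) (Proj1 u')"
| "step S u u' \<Longrightarrow> step S (Lam A u) (Lam A u')"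
| "step S u u' \<Longrightarrow> step S (App u v) (App u' v)"
| "step S v v' \<Longrightarrow> step S (App u v) (App u v')"
| "step S u u' \<Longrightarrow> step S (Inj0 u) (Inj0 u')"
| "step S u u' \<Longrightarrow> step S (Inj1 u) (Inj1 u')"
| "step S u u' \<Longrightarrow> step S (Case u A v B w) (Case u' A v B w)"
| "step S v v' \<Longrightarrow> step S (Case u A v B w) (Case u A v' B w)"
| "step S w w' \<Longrightarrow> step S (Case u A v B w) (Case u A v B w')"
| "step S u u' \<Longrightarrow> step S (TLam u) (TLam u')"
| "step S u u' \<Longrightarrow> step S (TApp u m) (TApp u' m)"
| "step S u u' \<Longrightarrow> step S (Pack m u) (Pack m u')"
| "step S u u' \<Longrightarrow> step S (Unpack u A v) (Unpack u' A v)"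
| "step S v v' \<Longrightarrow> step S (Unpack u A v) (Unpack u A v')"
| "step S u u' \<Longrightarrow> step S (Efq P u) (Efq P u')"

definition strongly_normalizable :: "('a \<Rightarrow> 'a \<Rightarrow> bool) \<Rightarrow> 'a \<Rightarrow> bool" where
  "strongly_normalizable R t \<longleftrightarrow> (\<nexists>s :: nat \<Rightarrow> 'a. s 0 = t \<and> (\<forall>n. R (s n) (s (Suc n))))"

end

theory Submission
  imports Defs
begin

text \<open>
  The proof rests on the observation that first-order terms play no computational role. Erase
  them, identify \<open>\<forall>\<alpha> A\<close> and \<open>\<exists>\<alpha> A\<close> with \<open>A\<close>, and all atoms with a single base type. What
  remains is the \<open>\<lambda>\<close>-calculus with pairs and sums and without commuting conversions: abstraction
  over and application to first-order terms disappear, \<open>(m, u)\<close> becomes \<open>u\<close>, the elimination of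
  \<open>\<exists>\<close> becomes a \<open>\<beta>\<close>-redex, and ex falso is dropped, since both its premise and its conclusion
  have the base type. The constant of the axiom of constant domains would get the type
  \<open>A \<or> B \<rightarrow> A \<or> B\<close>, so it can be represented by \<open>\<lambda>x. x\<close>: both of its reduction rules are then
  instances of \<open>\<beta>\<close>.

  Under this erasure every reduction step becomes exactly one step of the \<open>\<lambda>\<close>-calculus, except for
  \<open>(\<lambda>\<alpha>. u) m \<mapsto> u[m/\<alpha>]\<close>, which leaves the erased term unchanged but removes one application to a
  first-order term (\<open>step_erase\<close>). Hence a proof term is strongly normalizable as soon as its
  erasure is (\<open>terminates_if_erase\<close>), by a lexicographic induction.

  Strong normalization of the erased terms is shown by Tait's reducibility method.
  The reducible terms of each formula are strongly normalizing, closed under reduction, and contain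
  every neutral term all of whose reducts are reducible (\<open>candidate_red\<close>); the erasure of a typed
  proof term is reducible under every reducible substitution (\<open>red_erase\<close>). Since the
  definition of reducibility ignores first-order terms, it is invariant under their substitution
  (\<open>red_subst_fm\<close>); this is what makes the argument go through for the quantifier rules.
\<close>

section \<open>The lambda calculus with pairs and sums\<close>

text \<open>
  Proof terms without first-order terms and type annotations, again with de Bruijn indices.
  The Boolean argument of \<open>LProj\<close> and \<open>LInj\<close> selects the side, \<open>False\<close> standing for the left one.
  \<open>LCase u v w\<close> binds one variable in each of \<open>v\<close> and \<open>w\<close>.
\<close>

datatype lt =
    LVar nat
  | LPair lt lt
  | LProj bool lt
  | LAbs lt
  | LApp lt lt
  | LInj bool lt
  | LCase lt lt lt

primrec lrename :: "(nat \<Rightarrow> nat) \<Rightarrow> lt \<Rightarrow> lt" where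
  "lrename \<xi> (LVar i) = LVar (\<xi> i)"
| "lrename \<xi> (LPair u v) = LPair (lrename \<xi> u) (lrename \<xi> v)"
| "lrename \<xi> (LProj b u) = LProj b (lrename \<xi> u)"
| "lrename \<xi> (LAbs u) = LAbs (lrename (up_ren \<xi>) u)"
| "lrename \<xi> (LApp u v) = LApp (lrename \<xi> u) (lrename \<xi> v)"
| "lrename \<xi> (LInj b u) = LInj b (lrename \<xi> u)"
| "lrename \<xi> (LCase u v w) =
     LCase (lrename \<xi> u) (lrename (up_ren \<xi>) v) (lrename (up_ren \<xi>) w)"

definition lup :: "(nat \<Rightarrow> lt) \<Rightarrow> nat \<Rightarrow> lt" where
  "lup \<theta> i = (case i of 0 \<Rightarrow> LVar 0 | Suc j \<Rightarrow> lrename Suc (\<theta> j))"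

primrec lsubst :: "(nat \<Rightarrow> lt) \<Rightarrow> lt \<Rightarrow> lt" where
  "lsubst \<theta> (LVar i) = \<theta> i"
| "lsubst \<theta> (LPair u v) = LPair (lsubst \<theta> u) (lsubst \<theta> v)"
| "lsubst \<theta> (LProj b u) = LProj b (lsubst \<theta> u)"
| "lsubst \<theta> (LAbs u) = LAbs (lsubst (lup \<theta>) u)"
| "lsubst \<theta> (LApp u v) = LApp (lsubst \<theta> u) (lsubst \<theta> v)"
| "lsubst \<theta> (LInj b u) = LInj b (lsubst \<theta> u)"
| "lsubst \<theta> (LCase u v w) =
     LCase (lsubst \<theta> u) (lsubst (lup \<theta>) v) (lsubst (lup \<theta>) w)"

text \<open>
  \<open>lcons t \<theta>\<close> replaces the outermost variable by \<open>t\<close> and the others according to \<open>\<theta>\<close>;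
  \<open>linst t\<close> is the special case used by the reduction rules.
\<close>

definition lcons :: "lt \<Rightarrow> (nat \<Rightarrow> lt) \<Rightarrow> nat \<Rightarrow> lt" where
  "lcons t \<theta> i = (case i of 0 \<Rightarrow> t | Suc j \<Rightarrow> \<theta> j)"

abbreviation linst :: "lt \<Rightarrow> nat \<Rightarrow> lt" where
  "linst t \<equiv> lcons t LVar"

inductive lstep :: "lt \<Rightarrow> lt \<Rightarrow> bool" where
  beta: "lstep (LApp (LAbs u) t) (lsubst (linst t) u)"
| proj: "lstep (LProj b (LPair u v)) (if b then v else u)"
| case_inj: "lstep (LCase (LInj b u) v w) (lsubst (linst u) (if b then w else v))"
| pair1: "lstep u u' \<Longrightarrow> lstep (LPair u v) (LPair u' v)"
| pair2: "lstep v v' \<Longrightarrow> lstep (LPair u v) (LPair u v')"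
| proj_arg: "lstep u u' \<Longrightarrow> lstep (LProj b u) (LProj b u')"
| abs: "lstep u u' \<Longrightarrow> lstep (LAbs u) (LAbs u')"
| app1: "lstep u u' \<Longrightarrow> lstep (LApp u v) (LApp u' v)"
| app2: "lstep v v' \<Longrightarrow> lstep (LApp u v) (LApp u v')"
| inj: "lstep u u' \<Longrightarrow> lstep (LInj b u) (LInj b u')"
| case1: "lstep u u' \<Longrightarrow> lstep (LCase u v w) (LCase u' v w)"
| case2: "lstep v v' \<Longrightarrow> lstep (LCase u v w) (LCase u v' w)"
| case3: "lstep w w' \<Longrightarrow> lstep (LCase u v w) (LCase u v w')"

inductive_cases lstep_VarE: "lstep (LVar i) t"
inductive_cases lstep_PairE: "lstep (LPair u v) t"
inductive_cases lstep_ProjE: "lstep (LProj b u) t"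
inductive_cases lstep_AbsE: "lstep (LAbs u) t"
inductive_cases lstep_AppE: "lstep (LApp u v) t"
inductive_cases lstep_InjE: "lstep (LInj b u) t"

section \<open>Substitution\<close>

lemma lup_LVar: "lup LVar = LVar"
  by (auto simp: lup_def fun_eq_iff split: nat.split)

lemma lsubst_LVar: "lsubst LVar t = t"
  by (induction t) (simp_all add: lup_LVar)

lemma lup_comp_up_ren: "lup \<theta> \<circ> up_ren \<xi> = lup (\<theta> \<circ> \<xi>)"
  by (auto simp: lup_def up_ren_def fun_eq_iff split: nat.split)

lemma lsubst_lrename: "lsubst \<theta> (lrename \<xi> t) = lsubst (\<theta> \<circ> \<xi>) t"
  by (induction t arbitrary: \<theta> \<xi>) (simp_all add: lup_comp_up_ren)

lemma up_ren_comp: "up_ren \<xi> \<circ> up_ren \<zeta> = up_ren (\<xi> \<circ> \<zeta>)"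
  by (auto simp: up_ren_def fun_eq_iff split: nat.split)

lemma lrename_lrename: "lrename \<xi> (lrename \<zeta> t) = lrename (\<xi> \<circ> \<zeta>) t"
  by (induction t arbitrary: \<xi> \<zeta>) (simp_all add: up_ren_comp)

lemma up_ren_comp_Suc: "up_ren \<xi> \<circ> Suc = Suc \<circ> \<xi>"
  by (auto simp: up_ren_def)

lemma lrename_up_ren_comp_lup: "lrename (up_ren \<xi>) \<circ> lup \<theta> = lup (lrename \<xi> \<circ> \<theta>)"
  by (auto simp: lup_def up_ren_def lrename_lrename up_ren_comp_Suc[unfolded up_ren_def]
      fun_eq_iff intro!: arg_cong[where f = "\<lambda>\<xi>. lrename \<xi> _"] split: nat.split)

lemma lrename_lsubst: "lrename \<xi> (lsubst \<theta> t) = lsubst (lrename \<xi> \<circ> \<theta>) t"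
  by (induction t arbitrary: \<theta> \<xi>) (simp_all add: lrename_up_ren_comp_lup)

lemma lsubst_lup_comp_lup: "lsubst (lup \<theta>) \<circ> lup \<eta> = lup (lsubst \<theta> \<circ> \<eta>)"
proof
  fix i
  have "lup \<theta> \<circ> Suc = lrename Suc \<circ> \<theta>"
    by (auto simp: lup_def)
  then show "(lsubst (lup \<theta>) \<circ> lup \<eta>) i = lup (lsubst \<theta> \<circ> \<eta>) i"
    by (cases i) (simp_all add: lup_def[of \<eta>] lup_def[of "lsubst \<theta> \<circ> \<eta>"] lsubst_lrename
        lrename_lsubst, simp add: lup_def)
qed

lemma lsubst_lsubst: "lsubst \<theta> (lsubst \<eta> t) = lsubst (lsubst \<theta> \<circ> \<eta>) t"
  by (induction t arbitrary: \<theta> \<eta>) (simp_all add: lsubst_lup_comp_lup)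

lemma lsubst_linst_lup: "lsubst (linst t) (lsubst (lup \<theta>) u) = lsubst (lcons t \<theta>) u"
proof -
  have "linst t \<circ> Suc = LVar"
    by (auto simp: lcons_def)
  then have "lsubst (linst t) (lrename Suc s) = s" for s
    by (simp add: lsubst_lrename lsubst_LVar)
  then have "lsubst (linst t) \<circ> lup \<theta> = lcons t \<theta>"
    by (auto simp: lup_def lcons_def split: nat.split)
  then show ?thesis
    by (simp add: lsubst_lsubst)
qed

lemma lsubst_linst: "lsubst \<theta> (lsubst (linst t) u) = lsubst (linst (lsubst \<theta> t)) (lsubst (lup \<theta>) u)"
proof -
  have "lsubst \<theta> \<circ> linst t = lcons (lsubst \<theta> t) \<theta>"
    by (auto simp: lcons_def fun_eq_iff split: nat.split)
  then show ?thesis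
    unfolding lsubst_linst_lup by (simp add: lsubst_lsubst)
qed

lemma lstep_lsubst: "lstep t t' \<Longrightarrow> lstep (lsubst \<theta> t) (lsubst \<theta> t')"
proof (induction arbitrary: \<theta> rule: lstep.induct)
  case (beta u t)
  show ?case
    by (simp add: lsubst_linst lstep.beta)
next
  case (proj b u v)
  show ?case
    using lstep.proj[of b "lsubst \<theta> u" "lsubst \<theta> v"] by (cases b) simp_all
next
  case (case_inj b u v w)
  show ?case
    using lstep.case_inj[of b "lsubst \<theta> u" "lsubst (lup \<theta>) v" "lsubst (lup \<theta>) w"]
    by (cases b) (simp_all add: lsubst_linst)
qed (auto intro: lstep.intros)

section \<open>Termination\<close>

text \<open>Strong normalization in its inductive form, which supports induction on reduction.\<close>

abbreviation terminates :: "('a \<Rightarrow> 'a \<Rightarrow> bool) \<Rightarrow> 'a \<Rightarrow> bool" where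
  "terminates R \<equiv> Wellfounded.accp (\<lambda>x y. R y x)"

abbreviation SN :: "lt \<Rightarrow> bool" where
  "SN \<equiv> terminates lstep"

lemma strongly_normalizable_if_terminates:
  assumes "terminates R t"
  shows "strongly_normalizable R t"
proof -
  have "\<not> (s 0 = t \<and> (\<forall>n. R (s n) (s (Suc n))))" for s :: "nat \<Rightarrow> 'a"
    using assms
  proof (induction arbitrary: s rule: accp.induct)
    case (accI t)
    from accI.IH[of "s 1" "\<lambda>n. s (Suc n)"] show ?case
      by auto
  qed
  then show ?thesis
    by (auto simp: strongly_normalizable_def)
qed

lemma terminates_step: "terminates R t \<Longrightarrow> R t t' \<Longrightarrow> terminates R t'"
  by (rule accp_downward)

lemma terminates_inverse_image:
  assumes "\<And>t t'. R t t' \<Longrightarrow> Q (f t) (f t')" and "terminates Q (f t)"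
  shows "terminates R t"
  using assms(2)
proof (induction "f t" arbitrary: t rule: accp.induct)
  case accI
  then show ?case
    by (blast intro: accp.accI assms(1))
qed

lemma SN_if_SN_lsubst: "SN (lsubst \<theta> t) \<Longrightarrow> SN t"
  by (rule terminates_inverse_image[where f = "lsubst \<theta>"]) (auto intro: lstep_lsubst)

lemma SN_Inj:
  assumes "SN u"
  shows "SN (LInj b u)"
  using assms
  by (induction rule: accp.induct) (blast intro: accp.accI elim: lstep_InjE)

section \<open>Reducibility\<close>

text \<open>
  The reducible terms of a formula. Atoms behave like a base type, quantifiers are ignored. For a
  disjunction, \<open>u\<close> is required to be reducible only for those \<open>\<iota>\<^sub>i(u)\<close> that are actually reached;
  this suffices as there are no commuting conversions.
\<close>

primrec red :: "('f, 'p) fm \<Rightarrow> lt \<Rightarrow> bool" where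
  "red (Atom p ms) = SN"
| "red (Or A B) =
     (\<lambda>t. SN t \<and> (\<forall>b u. lstep\<^sup>*\<^sup>* t (LInj b u) \<longrightarrow> (if b then red B u else red A u)))"
| "red (And A B) = (\<lambda>t. red A (LProj False t) \<and> red B (LProj True t))"
| "red (Imp A B) = (\<lambda>t. \<forall>u. red A u \<longrightarrow> red B (LApp t u))"
| "red (Forall A) = red A"
| "red (Exists A) = red A"

lemma red_subst_fm: "red (subst_fm \<sigma> A) = red A"
  by (induction A arbitrary: \<sigma>) simp_all

lemma red_lift_fm: "red (lift_fm A) = red A"
  by (simp add: lift_fm_def red_subst_fm)

text \<open>Neutral terms are those whose elimination creates no redex at the root.\<close>

fun neutral :: "lt \<Rightarrow> bool" where
  "neutral (LAbs u) = False"
| "neutral (LPair u v) = False"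
| "neutral (LInj b u) = False"
| "neutral _ = True"

text \<open>
  The closure properties carried through the induction on formulas. The last one makes variables
  members of \<open>P\<close>, and it reduces membership of an elimination to that of its reducts.
\<close>

definition candidate :: "(lt \<Rightarrow> bool) \<Rightarrow> bool" where
  "candidate P \<longleftrightarrow>
     (\<forall>t. P t \<longrightarrow> SN t) \<and>
     (\<forall>t t'. P t \<longrightarrow> lstep t t' \<longrightarrow> P t') \<and>
     (\<forall>t. neutral t \<longrightarrow> (\<forall>t'. lstep t t' \<longrightarrow> P t') \<longrightarrow> P t)"

lemma candidateI:
  assumes "\<And>t. P t \<Longrightarrow> SN t"
    and "\<And>t t'. P t \<Longrightarrow> lstep t t' \<Longrightarrow> P t'"
    and "\<And>t. neutral t \<Longrightarrow> (\<And>t'. lstep t t' \<Longrightarrow> P t') \<Longrightarrow> P t"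
  shows "candidate P"
  using assms unfolding candidate_def by blast

lemma candidate_SN: "candidate P \<Longrightarrow> P t \<Longrightarrow> SN t"
  and candidate_step: "candidate P \<Longrightarrow> P t \<Longrightarrow> lstep t t' \<Longrightarrow> P t'"
  and candidate_neutral:
    "candidate P \<Longrightarrow> neutral t \<Longrightarrow> (\<And>t'. lstep t t' \<Longrightarrow> P t') \<Longrightarrow> P t"
  unfolding candidate_def by blast+

lemma candidate_Var: "candidate P \<Longrightarrow> P (LVar i)"
  by (rule candidate_neutral) (auto elim: lstep_VarE)

lemma candidate_red: "candidate (red A)"
proof (induction A)
  case (Atom p ms)
  show ?case
    by (rule candidateI) (auto intro: terminates_step accp.accI)
next
  case (Or A B)
  show ?case
  proof (rule candidateI)
    fix t
    assume "red (Or A B) t"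
    then show "SN t"
      by simp
  next
    fix t t'
    assume "red (Or A B) t" and "lstep t t'"
    then show "red (Or A B) t'"
      using terminates_step[of lstep t t'] converse_rtranclp_into_rtranclp[of lstep t t']
      unfolding red.simps by blast
  next
    fix t
    assume "neutral t" and *: "\<And>t'. lstep t t' \<Longrightarrow> red (Or A B) t'"
    have "SN t"
      using * by (auto intro: accp.accI)
    moreover have "if b then red B u else red A u" if "lstep\<^sup>*\<^sup>* t (LInj b u)" for b u
      using that
    proof (cases rule: converse_rtranclpE)
      case base
      with \<open>neutral t\<close> show ?thesis
        by simp
    next
      case (step t')
      with *[of t'] show ?thesis
        unfolding red.simps by blast
    qed
    ultimately show "red (Or A B) t"
      by simp
  qed
next
  case (And A B)
  show ?case
  proof (rule candidateI)
    fix t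
    assume "red (And A B) t"
    then have "SN (LProj False t)"
      using candidate_SN[OF And.IH(1)] by simp
    then show "SN t"
      by (rule terminates_inverse_image[rotated]) (rule lstep.proj_arg)
  next
    fix t t'
    assume "red (And A B) t" and "lstep t t'"
    then show "red (And A B) t'"
      using candidate_step[OF And.IH(1)] candidate_step[OF And.IH(2)] lstep.proj_arg
      unfolding red.simps by blast
  next
    fix t
    assume "neutral t" and *: "\<And>t'. lstep t t' \<Longrightarrow> red (And A B) t'"
    have "\<exists>t'. s = LProj b t' \<and> lstep t t'" if "lstep (LProj b t) s" for b s
      using that \<open>neutral t\<close> by (auto elim: lstep_ProjE)
    then show "red (And A B) t"
      using candidate_neutral[OF And.IH(1), of "LProj False t"]
        candidate_neutral[OF And.IH(2), of "LProj True t"] *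
      unfolding red.simps neutral.simps by blast
  qed
next
  case (Imp A B)
  show ?case
  proof (rule candidateI)
    fix t
    assume "red (Imp A B) t"
    then have "SN (LApp t (LVar 0))"
      using candidate_SN[OF Imp.IH(2)] candidate_Var[OF Imp.IH(1)] by simp
    then show "SN t"
      by (rule terminates_inverse_image[rotated]) (rule lstep.app1)
  next
    fix t t'
    assume "red (Imp A B) t" and "lstep t t'"
    then show "red (Imp A B) t'"
      using candidate_step[OF Imp.IH(2)] lstep.app1 unfolding red.simps by blast
  next
    fix t
    assume "neutral t" and *: "\<And>t'. lstep t t' \<Longrightarrow> red (Imp A B) t'"
    have "red B (LApp t u)" if "SN u" and "red A u" for u
      using that
    proof (induction rule: accp.induct)
      case (accI u)
      have "red B s" if "lstep (LApp t u) s" for s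
        using that
      proof cases
        case (beta v)
        with \<open>neutral t\<close> show ?thesis
          by simp
      next
        case (app1 t')
        with *[of t'] accI.prems show ?thesis
          by simp
      next
        case (app2 u')
        with accI.IH accI.prems candidate_step[OF Imp.IH(1)] show ?thesis
          by blast
      qed
      then show ?case
        using candidate_neutral[OF Imp.IH(2), of "LApp t u"] by simp
    qed
    then show "red (Imp A B) t"
      using candidate_SN[OF Imp.IH(1)] by simp
  qed
qed simp_all

lemmas SN_if_red = candidate_SN[OF candidate_red]
  and red_step = candidate_step[OF candidate_red]
  and red_neutral = candidate_neutral[OF candidate_red]
  and red_Var = candidate_Var[OF candidate_red]

text \<open>Variables are reducible, so \<open>u\<close> may be taken to be one; steps of \<open>v\<close> survive substitution.\<close>

lemma SN_body:
  assumes "\<And>u. red A u \<Longrightarrow> red C (lsubst (linst u) v)"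
  shows "SN v"
  using assms[OF red_Var] SN_if_red SN_if_SN_lsubst by blast

text \<open>
  Introduction forms are not neutral, but eliminations are. So \<open>red_Proj_Pair\<close>, \<open>red_App_Abs\<close> and
  \<open>red_Case_SN\<close> show that all reducts of an elimination are reducible, by nested inductions on the
  strong normalization of its constituents; the reduct at the root is reducible by the premises.
\<close>

lemma red_Proj_Pair:
  assumes "SN u" and "SN v" and "red A u" and "red B v"
  shows "red A (LProj False (LPair u v)) \<and> red B (LProj True (LPair u v))"
  using assms
proof (induction arbitrary: v rule: accp.induct)
  case (accI u)
  note outer_IH = accI.IH and outer_prems = accI.prems
  show ?case
    using \<open>SN v\<close> \<open>red B v\<close>
  proof (induction rule: accp.induct)
    case (accI v)
    have "SN v"
      using accI.hyps by (rule accp.accI)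
    have *: "red A (LProj False (LPair u' v)) \<and> red B (LProj True (LPair u' v))"
      if "lstep u u'" for u'
      using outer_IH[OF that \<open>SN v\<close>] that outer_prems red_step accI.prems by blast
    have **: "red A (LProj False (LPair u v')) \<and> red B (LProj True (LPair u v'))"
      if "lstep v v'" for v'
      using accI.IH[OF that] that accI.prems red_step by blast
    have "red A s" if "lstep (LProj False (LPair u v)) s" for s
      using that * ** outer_prems(2) by (auto elim!: lstep_ProjE lstep_PairE)
    moreover have "red B s" if "lstep (LProj True (LPair u v)) s" for s
      using that * ** accI.prems by (auto elim!: lstep_ProjE lstep_PairE)
    ultimately show ?case
      by (simp add: red_neutral)
  qed
qed

lemma red_App_Abs:
  assumes "SN v" and "SN u" and "red A u"
    and "\<And>u. red A u \<Longrightarrow> red B (lsubst (linst u) v)"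
  shows "red B (LApp (LAbs v) u)"
  using assms
proof (induction arbitrary: u rule: accp.induct)
  case (accI v)
  note outer_IH = accI.IH and outer_prems = accI.prems
  show ?case
    using \<open>SN u\<close> \<open>red A u\<close>
  proof (induction rule: accp.induct)
    case (accI u)
    have "SN u"
      using accI.hyps by (rule accp.accI)
    have *: "red B (LApp (LAbs v') u)" if "lstep v v'" for v'
      using outer_IH[OF that \<open>SN u\<close> accI.prems] outer_prems(3) that red_step lstep_lsubst by blast
    have **: "red B (LApp (LAbs v) u')" if "lstep u u'" for u'
      using accI.IH[OF that] that accI.prems red_step by blast
    have "red B s" if "lstep (LApp (LAbs v) u) s" for s
      using that * ** outer_prems(3)[OF accI.prems] by (auto elim!: lstep_AppE lstep_AbsE)
    then show ?case
      by (simp add: red_neutral)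
  qed
qed

lemma red_Abs:
  assumes "\<And>u. red A u \<Longrightarrow> red B (lsubst (linst u) v)"
  shows "red (Imp A B) (LAbs v)"
  using red_App_Abs[of v _ A B] SN_body[of A B v] SN_if_red[of A] assms by simp

lemma red_Case_SN:
  assumes "SN t" and "SN v" and "SN w" and "red (Or A B) t"
    and "\<And>u. red A u \<Longrightarrow> red C (lsubst (linst u) v)"
    and "\<And>u. red B u \<Longrightarrow> red C (lsubst (linst u) w)"
  shows "red C (LCase t v w)"
  using assms
proof (induction arbitrary: v w rule: accp.induct)
  case (accI t)
  note outer_IH = accI.IH and outer_prems = accI.prems
  have inj: "red A u" if "t = LInj False u" for u
    using outer_prems(3) that by fastforce
  have inj': "red B u" if "t = LInj True u" for u
    using outer_prems(3) that by fastforce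
  show ?case
    using \<open>SN v\<close> \<open>SN w\<close> outer_prems(4,5)
  proof (induction arbitrary: w rule: accp.induct)
    case (accI v)
    note middle_hyps = accI.hyps and middle_IH = accI.IH and middle_prems = accI.prems
    have "SN v"
      using middle_hyps by (rule accp.accI)
    show ?case
      using \<open>SN w\<close> middle_prems(3)
    proof (induction rule: accp.induct)
      case (accI w)
      have "SN w"
        using accI.hyps by (rule accp.accI)
      have 1: "red C (LCase t' v w)" if "lstep t t'" for t'
        using outer_IH[OF that \<open>SN v\<close> \<open>SN w\<close> red_step[OF outer_prems(3) that]]
          middle_prems(2) accI.prems by blast
      have 2: "red C (LCase t v' w)" if "lstep v v'" for v'
        using middle_IH[OF that \<open>SN w\<close>] middle_prems(2) accI.prems
          red_step lstep_lsubst that by blast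
      have 3: "red C (LCase t v w')" if "lstep w w'" for w'
        using accI.IH[OF that] accI.prems red_step lstep_lsubst that by blast
      have "red C s" if "lstep (LCase t v w) s" for s
        using that
      proof cases
        case (case_inj b u)
        then show ?thesis
          using inj inj' middle_prems(2) accI.prems by (cases b) auto
      qed (auto simp: 1 2 3)
      then show ?case
        by (simp add: red_neutral)
    qed
  qed
qed

lemma red_Case:
  assumes "red (Or A B) t"
    and "\<And>u. red A u \<Longrightarrow> red C (lsubst (linst u) v)"
    and "\<And>u. red B u \<Longrightarrow> red C (lsubst (linst u) w)"
  shows "red C (LCase t v w)"
  using red_Case_SN[OF SN_if_red[OF assms(1)] SN_body[OF assms(2)] SN_body[OF assms(3)]] assms
  by blast

lemma steps_from_Inj:
  assumes "lstep\<^sup>*\<^sup>* (LInj b u) t"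
  shows "\<exists>u'. t = LInj b u' \<and> lstep\<^sup>*\<^sup>* u u'"
  using assms
  by (induction rule: rtranclp_induct) (auto elim!: lstep_InjE intro: rtranclp.rtrancl_into_rtrancl)

lemma red_steps: "lstep\<^sup>*\<^sup>* t t' \<Longrightarrow> red A t \<Longrightarrow> red A t'"
  by (induction rule: rtranclp_induct) (auto intro: red_step)

lemma red_Inj:
  assumes "if b then red B u else red A u"
  shows "red (Or A B) (LInj b u)"
proof -
  have "SN (LInj b u)"
    using assms by (auto intro: SN_Inj SN_if_red split: if_splits)
  moreover have "if c then red B u' else red A u'" if "lstep\<^sup>*\<^sup>* (LInj b u) (LInj c u')" for c u'
    using steps_from_Inj[OF that] assms by (auto intro: red_steps split: if_splits)
  ultimately show ?thesis
    by simp
qed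

section \<open>Erasure\<close>

text \<open>
  The underlying \<open>\<lambda>\<close>-term of a proof term. The elimination of \<open>\<exists>\<close> becomes a \<open>\<beta>\<close>-redex, and the
  constant of the axiom of constant domains becomes the identity.
\<close>

primrec erase :: "('f, 'p) pt \<Rightarrow> lt" where
  "erase (Hyp i) = LVar i"
| "erase (Tuple u v) = LPair (erase u) (erase v)"
| "erase (Proj0 u) = LProj False (erase u)"
| "erase (Proj1 u) = LProj True (erase u)"
| "erase (Lam A u) = LAbs (erase u)"
| "erase (App u v) = LApp (erase u) (erase v)"
| "erase (Inj0 u) = LInj False (erase u)"
| "erase (Inj1 u) = LInj True (erase u)"
| "erase (Case u A v B w) = LCase (erase u) (erase v) (erase w)"
| "erase (TLam u) = erase u"
| "erase (TApp u m) = erase u"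
| "erase (Pack m u) = erase u"
| "erase (Unpack u A v) = LApp (LAbs (erase v)) (erase u)"
| "erase (CDAx A B) = LAbs (LVar 0)"
| "erase (Efq P u) = erase u"

text \<open>The number of applications to first-order terms in a proof term.\<close>

primrec tapps :: "('f, 'p) pt \<Rightarrow> nat" where
  "tapps (Hyp i) = 0"
| "tapps (Tuple u v) = tapps u + tapps v"
| "tapps (Proj0 u) = tapps u"
| "tapps (Proj1 u) = tapps u"
| "tapps (Lam A u) = tapps u"
| "tapps (App u v) = tapps u + tapps v"
| "tapps (Inj0 u) = tapps u"
| "tapps (Inj1 u) = tapps u"
| "tapps (Case u A v B w) = tapps u + tapps v + tapps w"
| "tapps (TLam u) = tapps u"
| "tapps (TApp u m) = Suc (tapps u)"
| "tapps (Pack m u) = tapps u"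
| "tapps (Unpack u A v) = tapps u + tapps v"
| "tapps (CDAx A B) = 0"
| "tapps (Efq P u) = tapps u"

lemma erase_tsubst_pt: "erase (tsubst_pt \<sigma> t) = erase t"
  by (induction t arbitrary: \<sigma>) simp_all

lemma tapps_tsubst_pt: "tapps (tsubst_pt \<sigma> t) = tapps t"
  by (induction t arbitrary: \<sigma>) simp_all

lemma erase_rename_pt: "erase (rename_pt \<xi> t) = lrename \<xi> (erase t)"
  by (induction t arbitrary: \<xi>) (simp_all add: up_ren_def)

lemma erase_comp_up_pt: "erase \<circ> up_pt \<theta> = lup (erase \<circ> \<theta>)"
  by (auto simp: up_pt_def lup_def erase_rename_pt fun_eq_iff split: nat.split)

lemma erase_comp_tup_pt: "erase \<circ> tup_pt \<theta> = erase \<circ> \<theta>"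
  by (auto simp: tup_pt_def erase_tsubst_pt)

lemma erase_subst_pt: "erase (subst_pt \<theta> t) = lsubst (erase \<circ> \<theta>) (erase t)"
  by (induction t arbitrary: \<theta>)
    (simp_all add: erase_comp_up_pt erase_comp_tup_pt, simp add: lup_def)

lemma erase_subst_inst_pt: "erase (subst_pt (inst_pt u) t) = lsubst (linst (erase u)) (erase t)"
proof -
  have "erase \<circ> inst_pt u = linst (erase u)"
    by (auto simp: inst_pt_def lcons_def fun_eq_iff split: nat.split)
  then show ?thesis
    by (simp add: erase_subst_pt)
qed

lemma contract_erase:
  assumes "contract S t t'"
  shows "lstep (erase t) (erase t') \<or> erase t = erase t' \<and> tapps t' < tapps t"
  using assms
proof cases
  case (3 u1)
  then show ?thesis
    using lstep.proj[of False "erase t'" "erase u1"] by simp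
next
  case (4 u0)
  then show ?thesis
    using lstep.proj[of True "erase u0" "erase t'"] by simp
next
  case (5 u A t0 B t1)
  then show ?thesis
    using lstep.case_inj[of False "erase u" "erase t0" "erase t1"]
    by (simp add: erase_subst_inst_pt)
next
  case (6 u A t0 B t1)
  then show ?thesis
    using lstep.case_inj[of True "erase u" "erase t0" "erase t1"]
    by (simp add: erase_subst_inst_pt)
next
  case (8 A B u)
  then show ?thesis
    using lstep.beta[of "LVar 0" "LInj False (erase u)"] by (simp add: lcons_def)
next
  case (9 A B u)
  then show ?thesis
    using lstep.beta[of "LVar 0" "LInj True (erase u)"] by (simp add: lcons_def erase_tsubst_pt)
qed (auto simp: erase_subst_inst_pt erase_tsubst_pt tapps_tsubst_pt intro: lstep.intros)

lemma step_erase: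
  assumes "step S t t'"
  shows "lstep (erase t) (erase t') \<or> erase t = erase t' \<and> tapps t' < tapps t"
  using assms
proof (induction rule: step.induct)
  case (1 t t')
  then show ?case
    by (rule contract_erase)
qed (auto intro: lstep.intros)

text \<open>
  The proof is by lexicographic induction on the erasure, ordered by reduction, and the number of
  applications to first-order terms.
\<close>

lemma terminates_if_erase:
  assumes "SN (erase t)"
  shows "terminates (step S) t"
  using assms
proof (induction "erase t" arbitrary: t rule: accp.induct)
  case accI
  note outer = accI
  show ?case
    using outer
  proof (induction "tapps t" arbitrary: t rule: less_induct)
    case less
    show ?case
    proof (rule accp.accI)
      fix t'
      assume "step S t t'"
      then consider "lstep (erase t) (erase t')"
        | "erase t = erase t'" and "tapps t' < tapps t"
        using step_erase by blast
      then show "terminates (step S) t'"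
      proof cases
        case 1
        then show ?thesis
          using less.prems(2) by blast
      next
        case 2
        then show ?thesis
          using less.hyps[of t'] less.prems by simp
      qed
    qed
  qed
qed

section \<open>Typed proof terms are reducible\<close>

lemma red_lcons:
  assumes "\<forall>i < length \<Gamma>. red (\<Gamma> ! i) (\<theta> i)" and "red A u"
  shows "\<forall>i < length (A # \<Gamma>). red ((A # \<Gamma>) ! i) (lcons u \<theta> i)"
  using assms by (auto simp: lcons_def less_Suc_eq_0_disj)

text \<open>
  The fundamental lemma. In the case of the existential elimination, whose erasure is a
  \<open>\<beta>\<close>-redex, the minor premise gives a reducible abstraction.
\<close>

lemma red_erase:
  assumes "has_type S \<Gamma> t A" and "\<forall>i < length \<Gamma>. red (\<Gamma> ! i) (\<theta> i)"
  shows "red A (lsubst \<theta> (erase t))"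
  using assms
proof (induction arbitrary: \<theta> rule: has_type.induct)
  case (Ax i \<Gamma> A)
  then show ?case
    by auto
next
  case (AndI \<Gamma> u A t B)
  from AndI.IH[OF AndI.prems] show ?case
    using red_Proj_Pair[of "lsubst \<theta> (erase u)" "lsubst \<theta> (erase t)" A B]
      SN_if_red[of A] SN_if_red[of B] by simp
next
  case (ImpI A \<Gamma> u B)
  have "red B (lsubst (linst s) (lsubst (lup \<theta>) (erase u)))" if "red A s" for s
    using ImpI.IH[OF red_lcons[OF ImpI.prems that]] by (simp add: lsubst_linst_lup)
  then have "red (Imp A B) (LAbs (lsubst (lup \<theta>) (erase u)))"
    by (rule red_Abs)
  then show ?case
    by simp
next
  case (OrI0 \<Gamma> u A B)
  then show ?case
    using red_Inj[of False B "lsubst \<theta> (erase u)" A] by simp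
next
  case (OrI1 \<Gamma> u B A)
  then show ?case
    using red_Inj[of True B "lsubst \<theta> (erase u)" A] by simp
next
  case (OrE \<Gamma> u A B v C w)
  have "red C (lsubst (linst s) (lsubst (lup \<theta>) (erase v)))" if "red A s" for s
    using OrE.IH(2)[OF red_lcons[OF OrE.prems that]] by (simp add: lsubst_linst_lup)
  moreover have "red C (lsubst (linst s) (lsubst (lup \<theta>) (erase w)))" if "red B s" for s
    using OrE.IH(3)[OF red_lcons[OF OrE.prems that]] by (simp add: lsubst_linst_lup)
  ultimately show ?case
    unfolding erase.simps lsubst.simps by (rule red_Case[OF OrE.IH(1)[OF OrE.prems]])
next
  case (ExistsE \<Gamma> u A t C)
  have "\<forall>i < length (map lift_fm \<Gamma>). red (map lift_fm \<Gamma> ! i) (\<theta> i)"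
    using ExistsE.prems by (simp add: red_lift_fm)
  then have "red C (lsubst (linst s) (lsubst (lup \<theta>) (erase t)))" if "red A s" for s
    using ExistsE.IH(2)[OF red_lcons[OF _ that]] by (simp add: lsubst_linst_lup red_lift_fm)
  then have "red (Imp A C) (LAbs (lsubst (lup \<theta>) (erase t)))"
    by (rule red_Abs)
  then show ?case
    using ExistsE.IH(1)[OF ExistsE.prems] by simp
next
  case (CD A B \<Gamma>)
  \<comment> \<open>After erasure the axiom has the type of the identity on \<open>A \<or> B\<close>.\<close>
  have "red (Imp (Or A B) (Or A B)) (LAbs (LVar 0))"
    by (rule red_Abs) (simp add: lcons_def)
  moreover have
    "red (Imp (Forall (Or A (lift_fm B))) (Or (Forall A) B)) = red (Imp (Or A B) (Or A B))"
    by (simp add: red_lift_fm)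
  moreover have "lsubst \<theta> (erase (CDAx A B)) = LAbs (LVar 0)"
    by (simp add: lup_def)
  ultimately show ?case
    by (simp only:)
qed (simp_all add: red_subst_fm red_lift_fm)

theorem theorem3:
  fixes S :: "('f, 'p :: countable) signature"
    and \<Gamma> :: "('f, 'p) fm list" and t :: "('f, 'p) pt" and A :: "('f, 'p) fm"
  assumes "wf_signature S"
    and "has_type S \<Gamma> t A"
  shows "strongly_normalizable (step S) t"
proof -
  have "red A (lsubst LVar (erase t))"
    using assms(2) by (rule red_erase) (simp add: red_Var)
  then have "SN (erase t)"
    by (simp add: lsubst_LVar SN_if_red)
  then show ?thesis
    by (intro strongly_normalizable_if_terminates terminates_if_erase)
qed

end
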